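(* Let $r\in\mathbb{Z}$, and let $A_r=A_r(y,z,q)$, $B_r=B_r(y,z,q)\in\mathbb{Q}[y^{\pm1}][[z,q]]$ be universal power series such that for every smooth projective surface $S$ over $\mathbb{C}$ and every $L\in\operatorname{Pic}(S)$ $$\sum_{n\ge 0} \operatorname{Ell}(S^{[n]},\mu(L)\otimes E^r)\, p^n=\frac{\mathbf{L}^{(2,0)}(-\phi_{-2,1},z)^{\frac{1}{2}(L^2+r^2\chi(\mathcal{O}_S))}A_r^{LK_S} B_r^{K_S^2}}{\left(\mathbf{L}(2\phi_{0,1},z)\left(1-r^2z\frac{\partial}{\partial z}\log \mathbf{L}^{(2,0)}(\phi_{-2,1},z)\right)\right)^{\frac{\chi(\mathcal{O}_S)}{2}}}$$ with the change of variables $p=z\,\mathbf{L}^{(2,0)}(-\phi_{-2,1},z)^{r^2}$. Then for every smooth projective surface $S$ over $\mathbb{C}$ and every $L\in \operatorname{Pic}(S)$ we have $$\sum_{n\ge 0} \overline\chi_{-y}(S^{[n]},\mu(L)\otimes E^r)\, p^n=\prod_{n>0} \left(\frac{(1-z^n)^2}{(1-z^ny)(1-z^n/y)}\right)^{\frac{n^2}{2}(L^2+r^2\chi(\mathcal{O}_S))}\cdot\frac{A_r(y,z,0)^{LK_S}\, B_r(y,z,0)^{K_S^2}}{\left(\widetilde\Delta(z,y)\left(1+r^2\sum_{n\ge 1}\sum_{d|n}(y^{d}-2+y^{-d})\frac{n^3}{d^3} z^n\right)\right)^{\frac{\chi(\mathcal{O}_S)}{2}}},$$ with the change of variables $p=z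 \prod_{n>0} \left(\frac{(1-z^n)^2}{(1-z^ny)(1-z^n/y)}\right)^{n^2r^2}$.
   Context: $S^{[n]}$ is the Hilbert scheme of $n$ points on $S$, a smooth projective variety of dimension $2n$. For a vector bundle $V$ on $S$, $V^{[n]}:=p_*q^*V$ is the tautological bundle on $S^{[n]}$, where $Z_n(S)\subset S\times S^{[n]}$ is the universal subscheme with projections $p:Z_n(S)\to S^{[n]}$, $q:Z_n(S)\to S$; this extends to a homomorphism $K^0(S)\to K^0(S^{[n]})$. For $L\in\operatorname{Pic}(S)$, $\mu(L):=\det((L-\mathcal{O}_S)^{[n]})$, and $E:=\det(\mathcal{O}_S^{[n]})$, both in $\operatorname{Pic}(S^{[n]})$. $K_S$ is the canonical class; $L^2$, $LK_S$, $K_S^2$ are intersection numbers. For a compact complex manifold $M$ and $W\in K^0(M)$, put $\overline\chi_{-y}(M,W):=y^{-\dim(M)/2}\sum_p(-y)^p\chi(M,\Omega^p_M\otimes W)$ (extended coefficientwise to power series with coefficients in $K^0(M)$). For a vector bundle $V$ of rank $\rho$, $\Lambda_tV:=\sum_{i=0}^{\rho}[\Lambda^iV]t^i$, $\operatorname{Sym}_tV:=\sum_{i\ge0}[\operatorname{Sym}^iV]t^i$, and $\mathcal{E}(V):=\bigotimes_{n\ge1}\Lambda_{-yq^n}V^\vee\otimes\Lambda_{-y^{-1}q^n}V\otimes\operatorname{Sym}_{q^n}(V\oplus V^\vee)$. The elliptic genus with values in $W$ is $\operatorname{Ell}(M,W):=\overline\chi_{-y}(M,\mathcal{E}(T_M)\otimes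 W)$. Functions: $\phi_{-2,1}(q,y):=(y^{1/2}-y^{-1/2})^2\prod_{n>0}\frac{(1-q^ny)^2(1-q^n/y)^2}{(1-q^n)^4}$, $\wp(q,y):=\frac1{12}+\frac{1}{(y^{1/2}-y^{-1/2})^2}+\sum_{n>0}\sum_{d|n}d(y^d-2+y^{-d})q^n$, $\phi_{0,1}(q,y):=12\,\wp(q,y)\,\phi_{-2,1}(q,y)$, $\widetilde\Delta(z,y):=\prod_{n>0}(1-z^n)^{20}(1-z^ny)^2(1-z^n/y)^2$. Lifts: for $f=\sum_{m,n}c_{m,n}q^my^n\in\mathbb{Q}[y^{\pm1}][[q]]$ (with $m\ge0$, $n\in\mathbb{Z}$), $$\mathbf{L}(f,z):=\prod_{l>0,\,m\ge0,\,n\in\mathbb{Z}}(1-z^lq^my^n)^{c_{lm,n}},\qquad \mathbf{L}^{(2,0)}(f,z):=\prod_{l>0,\,m\ge0,\,n\in\mathbb{Z}}(1-z^lq^my^n)^{l^2c_{lm,n}},$$ as power series in $z$ with constant term $1$. Rational powers of power series in $z$ with constant term $1$ are taken to have constant term $1$. "With the change of variables" means that the identity holds as an identity of formal series after substituting $p=p(z)$. $z$ is a formal variable. Power series $A_r,B_r$ as in the claim exist for every $r$. *)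

theory Defs
  imports
    "HOL-Analysis.Analysis"
    "HOL-Computational_Algebra.Formal_Laurent_Series"
    "Jordan_Normal_Form.Determinant"
begin

section \<open>Complex varieties as spaces with functions\<close>

text \<open>
  Varieties over the complex numbers are treated as in Serre's FAC: a set of closed points with
  its Zariski topology and a sheaf of complex-valued functions.  A section over an open set is a
  total function that is extended by 0 outside that open set, and the sheaf has no section at all
  over a set that is not open.  All varieties occurring below (smooth projective surfaces and
  their Hilbert schemes of points, which are smooth and hence reduced) are faithfully described in
  this language.  By GAGA it is immaterial whether the Euler characteristics below are computed
  algebraically, as is done here, or on the underlying compact complex manifold.
\<close>

record 'a fspace =
  zar :: "'a topology"
  reg :: "'a set \<Rightarrow> ('a \<Rightarrow> complex) set"

abbreviation pts :: "'a fspace \<Rightarrow> 'a set" where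
  "pts X \<equiv> topspace (zar X)"

definition restr :: "'a set \<Rightarrow> ('a \<Rightarrow> complex) \<Rightarrow> 'a \<Rightarrow> complex" where
  "restr U f = (\<lambda>x. if x \<in> U then f x else 0)"

inductive_set alg_gen :: "('a \<Rightarrow> complex) set \<Rightarrow> ('a \<Rightarrow> complex) set"
  for G :: "('a \<Rightarrow> complex) set" where
  const: "(\<lambda>_. c) \<in> alg_gen G"
| gen: "g \<in> G \<Longrightarrow> g \<in> alg_gen G"
| add: "f \<in> alg_gen G \<Longrightarrow> g \<in> alg_gen G \<Longrightarrow> (\<lambda>x. f x + g x) \<in> alg_gen G"
| mult: "f \<in> alg_gen G \<Longrightarrow> g \<in> alg_gen G \<Longrightarrow> (\<lambda>x. f x * g x) \<in> alg_gen G"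

text \<open>
  A chart is a set \<^term>\<open>D\<close> together with functions \<^term>\<open>G\<close> generating its ring of polynomial
  functions.  The open sets of the glued space are generated by the nonvanishing loci of polynomial
  functions on the charts; regular functions are locally quotients of such functions.
\<close>

definition chart_zar :: "('a set \<times> ('a \<Rightarrow> complex) set) set \<Rightarrow> 'a topology" where
  "chart_zar C = topology_generated_by {{x \<in> D. f x \<noteq> 0} | D G f. (D, G) \<in> C \<and> f \<in> alg_gen G}"

definition chart_space :: "('a set \<times> ('a \<Rightarrow> complex) set) set \<Rightarrow> 'a fspace" where
  "chart_space C = \<lparr> zar = chart_zar C,
     reg = (\<lambda>U. {h. openin (chart_zar C) U \<and> (\<forall>x. x \<notin> U \<longrightarrow> h x = 0) \<and>
       (\<forall>x\<in>U. \<exists>D G N. \<exists>f\<in>alg_gen G. \<exists>g\<in>alg_gen G.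
          (D, G) \<in> C \<and> openin (chart_zar C) N \<and> x \<in> N \<and> N \<subseteq> U \<inter> D \<and>
          (\<forall>y\<in>N. g y \<noteq> 0 \<and> h y = f y / g y))}) \<rparr>"

text \<open>
  An open set is affine if it is, with its induced structure, the maximal spectrum of a finitely
  generated algebra of functions: every character of its coordinate ring is the evaluation at
  exactly one of its points.
\<close>

definition is_character :: "'a fspace \<Rightarrow> 'a set \<Rightarrow> (('a \<Rightarrow> complex) \<Rightarrow> complex) \<Rightarrow> bool" where
  "is_character X U \<phi> \<longleftrightarrow> \<phi> (restr U (\<lambda>_. 1)) = 1 \<and>
     (\<forall>f\<in>reg X U. \<forall>g\<in>reg X U. \<forall>c. \<phi> (\<lambda>x. f x + g x) = \<phi> f + \<phi> g \<and>
        \<phi> (\<lambda>x. f x * g x) = \<phi> f * \<phi> g \<and> \<phi> (\<lambda>x. c * f x) = c * \<phi> f)"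

definition affine_open :: "'a fspace \<Rightarrow> 'a set \<Rightarrow> bool" where
  "affine_open X U \<longleftrightarrow> openin (zar X) U \<and>
     (\<exists>G. finite G \<and> reg X U = restr U ` alg_gen G \<and>
        (\<forall>W\<subseteq>U. (openin (zar X) W \<longleftrightarrow> openin (zar (chart_space {(U, G)})) W) \<and>
               reg X W = reg (chart_space {(U, G)}) W)) \<and>
     (\<forall>\<phi>. is_character X U \<phi> \<longrightarrow> (\<exists>!x. x \<in> U \<and> (\<forall>f\<in>reg X U. \<phi> f = f x)))"

definition irreducible_in :: "'a topology \<Rightarrow> 'a set \<Rightarrow> bool" where
  "irreducible_in T C \<longleftrightarrow> C \<noteq> {} \<and>
     (\<forall>A B. closedin T A \<and> closedin T B \<and> C \<subseteq> A \<union> B \<longrightarrow> C \<subseteq> A \<or> C \<subseteq> B)"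

definition vdim :: "'a fspace \<Rightarrow> nat" where
  "vdim X = (GREATEST n. \<exists>Y :: nat \<Rightarrow> 'a set.
     (\<forall>i\<le>n. closedin (zar X) (Y i) \<and> irreducible_in (zar X) (Y i)) \<and> (\<forall>i<n. Y i \<subset> Y (Suc i)))"

section \<open>Bases and dimensions of quotients\<close>

text \<open>
  Vector spaces are spaces of complex-valued functions.  The vectors \<open>e 0, ..., e (n - 1)\<close> of
  \<^term>\<open>A\<close> represent a basis of the quotient of \<^term>\<open>A\<close> by its subspace \<^term>\<open>B\<close>.
\<close>

definition lincomb :: "nat \<Rightarrow> (nat \<Rightarrow> complex) \<Rightarrow> (nat \<Rightarrow> 'k \<Rightarrow> complex) \<Rightarrow> 'k \<Rightarrow> complex" where
  "lincomb n c e = (\<lambda>k. \<Sum>i<n. c i * e i k)"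

definition basis_mod ::
  "('k \<Rightarrow> complex) set \<Rightarrow> ('k \<Rightarrow> complex) set \<Rightarrow> nat \<Rightarrow> (nat \<Rightarrow> 'k \<Rightarrow> complex) \<Rightarrow> bool" where
  "basis_mod A B n e \<longleftrightarrow> (\<forall>i<n. e i \<in> A) \<and>
     (\<forall>a\<in>A. \<exists>c. (\<lambda>k. a k - lincomb n c e k) \<in> B) \<and>
     (\<forall>c. lincomb n c e \<in> B \<longrightarrow> (\<forall>i<n. c i = 0))"

definition qdim :: "('k \<Rightarrow> complex) set \<Rightarrow> ('k \<Rightarrow> complex) set \<Rightarrow> nat" where
  "qdim A B = (THE n. \<exists>e. basis_mod A B n e)"

definition coord ::
  "('k \<Rightarrow> complex) set \<Rightarrow> nat \<Rightarrow> (nat \<Rightarrow> 'k \<Rightarrow> complex) \<Rightarrow> ('k \<Rightarrow> complex) \<Rightarrow> nat \<Rightarrow> complex" where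
  "coord B n e a = (SOME c. (\<lambda>k. a k - lincomb n c e k) \<in> B)"

section \<open>Smooth projective surfaces\<close>

definition max_ideal :: "'a fspace \<Rightarrow> 'a set \<Rightarrow> 'a \<Rightarrow> ('a \<Rightarrow> complex) set" where
  "max_ideal X U x = {f \<in> reg X U. f x = 0}"

definition ideal_square :: "('a \<Rightarrow> complex) set \<Rightarrow> ('a \<Rightarrow> complex) set" where
  "ideal_square I = {h. \<exists>k :: nat. \<exists>f g. (\<forall>i<k. f i \<in> I \<and> g i \<in> I) \<and>
     h = (\<lambda>x. \<Sum>i<k. f i x * g i x)}"

text \<open>Smoothness: the cotangent space at every point has the dimension of the variety.\<close>

definition smooth_variety :: "'a fspace \<Rightarrow> bool" where
  "smooth_variety X \<longleftrightarrow> irreducible_in (zar X) (pts X) \<and>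
     (\<forall>x\<in>pts X. \<exists>U. affine_open X U \<and> x \<in> U \<and>
        (\<exists>e. basis_mod (max_ideal X U x) (ideal_square (max_ideal X U x)) (vdim X) e))"

text \<open>
  A point of projective \<^term>\<open>N\<close>-space is represented by its homogeneous coordinate vector whose
  first nonzero entry is 1.
\<close>

type_synonym proj_pt = "nat \<Rightarrow> complex"

definition proj_pts :: "nat \<Rightarrow> proj_pt set" where
  "proj_pts N = {v. (\<exists>k\<le>N. v k = 1 \<and> (\<forall>i<k. v i = 0)) \<and> (\<forall>i>N. v i = 0)}"

definition proj_charts :: "nat \<Rightarrow> proj_pt set \<Rightarrow> (proj_pt set \<times> (proj_pt \<Rightarrow> complex) set) set" where
  "proj_charts N C = {({v \<in> C. v i \<noteq> 0}, {\<lambda>v. v j / v i | j. j \<le> N}) | i. i \<le> N}"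

definition smooth_projective_surface :: "proj_pt fspace \<Rightarrow> bool" where
  "smooth_projective_surface S \<longleftrightarrow>
     (\<exists>N C. closedin (zar (chart_space (proj_charts N (proj_pts N)))) C \<and>
        S = chart_space (proj_charts N C)) \<and>
     vdim S = 2 \<and> smooth_variety S"

section \<open>Vector bundles\<close>

text \<open>
  A vector bundle is given by an affine open neighbourhood \<^term>\<open>nbhd V x\<close> of every point
  \<^term>\<open>x\<close>, a frame over each of these, and transition matrices: if \<open>s x\<close> denotes the column of
  components of a section in the frame with index \<open>x\<close>, then \<open>s x = glue V x y * s y\<close>.
\<close>

record 'a vbundle =
  rank :: nat
  nbhd :: "'a \<Rightarrow> 'a set"
  glue :: "'a \<Rightarrow> 'a \<Rightarrow> 'a \<Rightarrow> complex mat"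

definition is_vbundle :: "'a fspace \<Rightarrow> 'a vbundle \<Rightarrow> bool" where
  "is_vbundle X V \<longleftrightarrow>
     (\<forall>x\<in>pts X. x \<in> nbhd V x \<and> affine_open X (nbhd V x)) \<and>
     (\<forall>x\<in>pts X. \<forall>y\<in>pts X.
        (\<forall>z\<in>nbhd V x \<inter> nbhd V y. glue V x y z \<in> carrier_mat (rank V) (rank V)) \<and>
        (\<forall>i<rank V. \<forall>j<rank V.
           restr (nbhd V x \<inter> nbhd V y) (\<lambda>z. glue V x y z $$ (i, j))
             \<in> reg X (nbhd V x \<inter> nbhd V y))) \<and>
     (\<forall>x\<in>pts X. \<forall>z\<in>nbhd V x. glue V x x z = 1\<^sub>m (rank V)) \<and>
     (\<forall>w\<in>pts X. \<forall>x\<in>pts X. \<forall>y\<in>pts X. \<forall>z\<in>nbhd V w \<inter> nbhd V x \<inter> nbhd V y.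
        glue V w x z * glue V x y z = glue V w y z)"

definition is_line_bundle :: "'a fspace \<Rightarrow> 'a vbundle \<Rightarrow> bool" where
  "is_line_bundle X L \<longleftrightarrow> is_vbundle X L \<and> rank L = 1"

definition trivial_on :: "('a \<Rightarrow> 'a set) \<Rightarrow> 'a vbundle" where
  "trivial_on U = \<lparr> rank = 1, nbhd = U, glue = (\<lambda>_ _ _. 1\<^sub>m 1) \<rparr>"

definition structure_sheaf :: "'a fspace \<Rightarrow> 'a vbundle" where
  "structure_sheaf X = trivial_on (SOME U. \<forall>x\<in>pts X. x \<in> U x \<and> affine_open X (U x))"

definition dual :: "'a vbundle \<Rightarrow> 'a vbundle" where
  "dual V = \<lparr> rank = rank V, nbhd = nbhd V, glue = (\<lambda>x y z. transpose_mat (glue V y x z)) \<rparr>"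

definition direct_sum :: "'a vbundle \<Rightarrow> 'a vbundle \<Rightarrow> 'a vbundle" where
  "direct_sum V W = \<lparr> rank = rank V + rank W, nbhd = (\<lambda>x. nbhd V x \<inter> nbhd W x),
     glue = (\<lambda>x y z. four_block_mat (glue V x y z) (0\<^sub>m (rank V) (rank W))
                                    (0\<^sub>m (rank W) (rank V)) (glue W x y z)) \<rparr>"

definition kronecker :: "complex mat \<Rightarrow> complex mat \<Rightarrow> complex mat" where
  "kronecker A B = mat (dim_row A * dim_row B) (dim_col A * dim_col B)
     (\<lambda>(i, j). A $$ (i div dim_row B, j div dim_col B) * B $$ (i mod dim_row B, j mod dim_col B))"

definition tensor :: "'a vbundle \<Rightarrow> 'a vbundle \<Rightarrow> 'a vbundle" where
  "tensor V W = \<lparr> rank = rank V * rank W, nbhd = (\<lambda>x. nbhd V x \<inter> nbhd W x),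
     glue = (\<lambda>x y z. kronecker (glue V x y z) (glue W x y z)) \<rparr>"

definition det_bundle :: "'a vbundle \<Rightarrow> 'a vbundle" where
  "det_bundle V = \<lparr> rank = 1, nbhd = nbhd V,
     glue = (\<lambda>x y z. mat 1 1 (\<lambda>_. Determinant.det (glue V x y z))) \<rparr>"

text \<open>Integer tensor powers of a line bundle.\<close>

definition line_power :: "'a vbundle \<Rightarrow> int \<Rightarrow> 'a vbundle" where
  "line_power L r = \<lparr> rank = 1, nbhd = nbhd L,
     glue = (\<lambda>x y z. mat 1 1 (\<lambda>_. (glue L x y z $$ (0, 0)) powi r)) \<rparr>"

text \<open>
  The frame of the exterior power consists of the wedge products of the frame vectors along
  strictly increasing index lists; its transition matrices are compound matrices.
\<close>

definition ext_index :: "nat \<Rightarrow> nat \<Rightarrow> nat list list" where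
  "ext_index n k = filter (\<lambda>I. length I = k) (subseqs [0..<n])"

definition ext_power :: "nat \<Rightarrow> 'a vbundle \<Rightarrow> 'a vbundle" where
  "ext_power k V = (let B = ext_index (rank V) k; N = length B in
     \<lparr> rank = N, nbhd = nbhd V,
       glue = (\<lambda>x y z. mat N N (\<lambda>(a, b).
         Determinant.det (mat k k (\<lambda>(i, j). glue V x y z $$ (B ! a ! i, B ! b ! j))))) \<rparr>)"

text \<open>The frame of the symmetric power consists of the monomials along weakly increasing lists.\<close>

definition sym_index :: "nat \<Rightarrow> nat \<Rightarrow> nat list list" where
  "sym_index n k = filter sorted (List.n_lists k [0..<n])"

definition sym_power :: "nat \<Rightarrow> 'a vbundle \<Rightarrow> 'a vbundle" where
  "sym_power k V = (let B = sym_index (rank V) k; N = length B in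
     \<lparr> rank = N, nbhd = nbhd V,
       glue = (\<lambda>x y z. mat N N (\<lambda>(a, b).
         \<Sum>I | I \<in> set (List.n_lists k [0..<rank V]) \<and> sort I = B ! a.
           \<Prod>t<k. glue V x y z $$ (I ! t, B ! b ! t))) \<rparr>)"

section \<open>Cohomology\<close>

text \<open>A section is stored through its components: frame index, point, component index.\<close>

definition bsections :: "'a fspace \<Rightarrow> 'a vbundle \<Rightarrow> 'a set \<Rightarrow> ('a \<times> 'a \<times> nat \<Rightarrow> complex) set" where
  "bsections X V U = {s.
     (\<forall>x z i. x \<notin> pts X \<or> i \<ge> rank V \<longrightarrow> s (x, z, i) = 0) \<and>
     (\<forall>x\<in>pts X. \<forall>i<rank V. (\<lambda>z. s (x, z, i)) \<in> reg X (U \<inter> nbhd V x)) \<and>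
     (\<forall>x\<in>pts X. \<forall>y\<in>pts X. \<forall>z\<in>U \<inter> nbhd V x \<inter> nbhd V y. \<forall>i<rank V.
        s (x, z, i) = (\<Sum>j<rank V. glue V x y z $$ (i, j) * s (y, z, j)))}"

definition brestr :: "'a set \<Rightarrow> ('a \<times> 'a \<times> nat \<Rightarrow> complex) \<Rightarrow> 'a \<times> 'a \<times> nat \<Rightarrow> complex" where
  "brestr U s = (\<lambda>(x, z, i). if z \<in> U then s (x, z, i) else 0)"

text \<open>
  The Cech complex with respect to the affine cover by the sets \<^term>\<open>nbhd V x\<close>.  Varieties being
  separated, all finite intersections of these sets are affine, so its cohomology is the sheaf
  cohomology of the bundle.
\<close>

definition cech_cochains ::
  "'a fspace \<Rightarrow> 'a vbundle \<Rightarrow> nat \<Rightarrow> ('a list \<times> 'a \<times> 'a \<times> nat \<Rightarrow> complex) set" where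
  "cech_cochains X V p = {\<sigma>. \<forall>xs.
     if length xs = Suc p \<and> set xs \<subseteq> pts X
     then (\<lambda>k. \<sigma> (xs, k)) \<in> bsections X V (\<Inter>x\<in>set xs. nbhd V x)
     else (\<forall>k. \<sigma> (xs, k) = 0)}"

definition cech_diff ::
  "'a fspace \<Rightarrow> 'a vbundle \<Rightarrow> ('a list \<times> 'a \<times> 'a \<times> nat \<Rightarrow> complex) \<Rightarrow>
     'a list \<times> 'a \<times> 'a \<times> nat \<Rightarrow> complex" where
  "cech_diff X V \<sigma> = (\<lambda>(xs, x, z, i).
     if set xs \<subseteq> pts X \<and> z \<in> (\<Inter>w\<in>set xs. nbhd V w)
     then \<Sum>j<length xs. (-1) ^ j * \<sigma> (take j xs @ drop (Suc j) xs, x, z, i)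
     else 0)"

definition cech_cocycles ::
  "'a fspace \<Rightarrow> 'a vbundle \<Rightarrow> nat \<Rightarrow> ('a list \<times> 'a \<times> 'a \<times> nat \<Rightarrow> complex) set" where
  "cech_cocycles X V p = {\<sigma> \<in> cech_cochains X V p. cech_diff X V \<sigma> = (\<lambda>_. 0)}"

definition cech_coboundaries ::
  "'a fspace \<Rightarrow> 'a vbundle \<Rightarrow> nat \<Rightarrow> ('a list \<times> 'a \<times> 'a \<times> nat \<Rightarrow> complex) set" where
  "cech_coboundaries X V p =
     (case p of 0 \<Rightarrow> {\<lambda>_. 0} | Suc p' \<Rightarrow> cech_diff X V ` cech_cochains X V p')"

definition hdim :: "'a fspace \<Rightarrow> 'a vbundle \<Rightarrow> nat \<Rightarrow> nat" where
  "hdim X V p = qdim (cech_cocycles X V p) (cech_coboundaries X V p)"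

definition euler_char :: "'a fspace \<Rightarrow> 'a vbundle \<Rightarrow> int" where
  "euler_char X V = (\<Sum>p=0..vdim X. (-1) ^ p * int (hdim X V p))"

section \<open>Tangent bundle, intersection numbers\<close>

text \<open>The local ring at a point, as an algebra of functions (not up to equality of germs).\<close>

definition regular_at :: "'a fspace \<Rightarrow> 'a \<Rightarrow> ('a \<Rightarrow> complex) set" where
  "regular_at X z = {f. \<exists>W. openin (zar X) W \<and> z \<in> W \<and> restr W f \<in> reg X W}"

text \<open>
  Point derivations; the Leibniz rule forces them to depend on the germ only, because the
  indicator function of a neighbourhood of \<^term>\<open>z\<close> is regular at \<^term>\<open>z\<close>.
\<close>

definition tangent_space :: "'a fspace \<Rightarrow> 'a \<Rightarrow> (('a \<Rightarrow> complex) \<Rightarrow> complex) set" where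
  "tangent_space X z = {D. (\<forall>f. f \<notin> regular_at X z \<longrightarrow> D f = 0) \<and>
     (\<forall>f\<in>regular_at X z. \<forall>g\<in>regular_at X z. \<forall>c. D (\<lambda>x. f x + g x) = D f + D g \<and>
        D (\<lambda>x. c * f x) = c * D f \<and> D (\<lambda>x. f x * g x) = f z * D g + g z * D f)}"

definition tangent_frames ::
  "'a fspace \<Rightarrow> ('a \<Rightarrow> 'a set) \<times> ('a \<Rightarrow> 'a \<Rightarrow> nat \<Rightarrow> ('a \<Rightarrow> complex) \<Rightarrow> complex) \<Rightarrow> bool" where
  "tangent_frames X = (\<lambda>(U, e). \<forall>x\<in>pts X. x \<in> U x \<and> affine_open X (U x) \<and>
     (\<forall>z\<in>U x. basis_mod (tangent_space X z) {\<lambda>_. 0} (vdim X) (e x z)) \<and>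
     (\<forall>W f i. openin (zar X) W \<and> W \<subseteq> U x \<and> f \<in> reg X W \<and> i < vdim X \<longrightarrow>
        restr W (\<lambda>z. e x z i f) \<in> reg X W))"

definition tangent_bundle :: "'a fspace \<Rightarrow> 'a vbundle" where
  "tangent_bundle X = (let (U, e) = (SOME F. tangent_frames X F) in
     \<lparr> rank = vdim X, nbhd = U,
       glue = (\<lambda>x y z. mat (vdim X) (vdim X)
         (\<lambda>(i, j). coord {\<lambda>_. 0} (vdim X) (e x z) (e y z j) i)) \<rparr>)"

definition forms :: "nat \<Rightarrow> 'a fspace \<Rightarrow> 'a vbundle" where
  "forms p X = ext_power p (dual (tangent_bundle X))"

definition canonical_bundle :: "'a fspace \<Rightarrow> 'a vbundle" where
  "canonical_bundle X = det_bundle (dual (tangent_bundle X))"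

text \<open>
  The intersection number of two line bundles on a surface, in terms of Euler characteristics
  (the usual definition without recourse to Chern classes).
\<close>

definition intersection :: "'a fspace \<Rightarrow> 'a vbundle \<Rightarrow> 'a vbundle \<Rightarrow> int" where
  "intersection S L M = euler_char S (structure_sheaf S) - euler_char S (dual L)
     - euler_char S (dual M) + euler_char S (tensor (dual L) (dual M))"

section \<open>The Hilbert scheme of points\<close>

text \<open>
  A closed subscheme is represented by its ideal sheaf.
\<close>

type_synonym 'a ideals = "'a set \<Rightarrow> ('a \<Rightarrow> complex) set"

definition ideal_sheaf :: "'a fspace \<Rightarrow> 'a ideals \<Rightarrow> bool" where
  "ideal_sheaf X J \<longleftrightarrow> (\<forall>U. if openin (zar X) U
     then J U \<subseteq> reg X U \<and> (\<lambda>_. 0) \<in> J U \<and>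
       (\<forall>f\<in>J U. \<forall>g\<in>J U. (\<lambda>x. f x + g x) \<in> J U) \<and>
       (\<forall>f\<in>J U. \<forall>g\<in>reg X U. (\<lambda>x. g x * f x) \<in> J U) \<and>
       (\<forall>f\<in>J U. \<forall>V. openin (zar X) V \<and> V \<subseteq> U \<longrightarrow> restr V f \<in> J V) \<and>
       (\<forall>f\<in>reg X U. (\<forall>x\<in>U. \<exists>V. openin (zar X) V \<and> x \<in> V \<and> V \<subseteq> U \<and> restr V f \<in> J V) \<longrightarrow> f \<in> J U)
     else J U = {})"

text \<open>
  The subscheme is contained in the open set \<^term>\<open>U\<close>: its ideal is trivial on some \<^term>\<open>V\<close>
  that covers \<^term>\<open>X\<close> together with \<^term>\<open>U\<close>.
\<close>

definition supported_in :: "'a fspace \<Rightarrow> 'a ideals \<Rightarrow> 'a set \<Rightarrow> bool" where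
  "supported_in X J U \<longleftrightarrow>
     (\<exists>V. openin (zar X) V \<and> U \<union> V = pts X \<and> restr V (\<lambda>_. 1) \<in> J V)"

definition hilb_pts :: "'a fspace \<Rightarrow> nat \<Rightarrow> 'a ideals set" where
  "hilb_pts X n = {J. ideal_sheaf X J \<and>
     (\<exists>U e. affine_open X U \<and> supported_in X J U \<and> basis_mod (reg X U) (J U) n e)}"

text \<open>
  For an affine open \<^term>\<open>U\<close> and functions \<open>b 0, ..., b (n - 1)\<close> on it, the subschemes inside
  \<^term>\<open>U\<close> on whose coordinate ring these functions restrict to a basis form an affine chart; its
  coordinate ring is generated by the coefficients expressing functions on \<^term>\<open>U\<close> in this basis.
\<close>

definition hilb_chart :: "'a fspace \<Rightarrow> nat \<Rightarrow> 'a set \<Rightarrow> (nat \<Rightarrow> 'a \<Rightarrow> complex) \<Rightarrow> 'a ideals set" where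
  "hilb_chart X n U b =
     {J \<in> hilb_pts X n. supported_in X J U \<and> basis_mod (reg X U) (J U) n b}"

definition hilb :: "'a fspace \<Rightarrow> nat \<Rightarrow> 'a ideals fspace" where
  "hilb X n = chart_space
     {(hilb_chart X n U b, {\<lambda>J. coord (J U) n b a j | a j. a \<in> reg X U \<and> j < n}) | U b.
        affine_open X U \<and> (\<forall>i<n. b i \<in> reg X U)}"

text \<open>Sections over \<^term>\<open>U\<close> of the product of the ideal sheaf \<^term>\<open>J\<close> with \<^term>\<open>V\<close>.\<close>

definition ideal_sections ::
  "'a fspace \<Rightarrow> 'a vbundle \<Rightarrow> 'a ideals \<Rightarrow> 'a set \<Rightarrow> ('a \<times> 'a \<times> nat \<Rightarrow> complex) set" where
  "ideal_sections X V J U =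
     {s \<in> bsections X V U. \<forall>x\<in>pts X. \<forall>i<rank V. (\<lambda>z. s (x, z, i)) \<in> J (U \<inter> nbhd V x)}"

text \<open>
  The fibre of \<open>p_* q^* V\<close> at a subscheme with ideal \<^term>\<open>J\<close> is the space of sections of the
  restriction of \<^term>\<open>V\<close> to that subscheme, that is, the quotient of the sections of
  \<^term>\<open>V\<close> by those of the product with \<^term>\<open>J\<close>, over any affine open set that contains the
  subscheme.  Local frames are given by sections of \<^term>\<open>V\<close> over such an open set.
\<close>

definition taut_frames ::
  "'a fspace \<Rightarrow> nat \<Rightarrow> 'a vbundle \<Rightarrow>
     ('a ideals \<Rightarrow> 'a ideals set) \<times> ('a ideals \<Rightarrow> 'a set) \<times>
     ('a ideals \<Rightarrow> nat \<Rightarrow> 'a \<times> 'a \<times> nat \<Rightarrow> complex) \<Rightarrow> bool" where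
  "taut_frames X n V = (\<lambda>(W, U, s). \<forall>J\<in>hilb_pts X n.
     J \<in> W J \<and> affine_open (hilb X n) (W J) \<and> affine_open X (U J) \<and>
     (\<forall>I\<in>W J. supported_in X I (U J) \<and>
        basis_mod (bsections X V (U J)) (ideal_sections X V I (U J)) (n * rank V) (s J)))"

definition taut :: "'a fspace \<Rightarrow> nat \<Rightarrow> 'a vbundle \<Rightarrow> 'a ideals vbundle" where
  "taut X n V = (let (W, U, s) = (SOME F. taut_frames X n V F) in
     \<lparr> rank = n * rank V, nbhd = W,
       glue = (\<lambda>J J' I. mat (n * rank V) (n * rank V)
         (\<lambda>(i, j). coord (ideal_sections X V I (U J \<inter> U J')) (n * rank V)
            (\<lambda>k. brestr (U J \<inter> U J') (s J k)) (brestr (U J \<inter> U J') (s J' j)) i)) \<rparr>)"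

section \<open>K-theory classes, tautological line bundles\<close>

text \<open>
  Classes in K-theory with coefficients are represented by formal linear combinations of vector
  bundles, given as lists of pairs of a coefficient and a bundle.  The tautological bundle and the
  Euler characteristic extend linearly, the determinant multiplicatively.
\<close>

type_synonym ('c, 'a) kclass = "('c \<times> 'a vbundle) list"

definition ktaut :: "'a fspace \<Rightarrow> nat \<Rightarrow> (int, 'a) kclass \<Rightarrow> (int, 'a ideals) kclass" where
  "ktaut X n W = map (\<lambda>(c, V). (c, taut X n V)) W"

definition kdet :: "'a fspace \<Rightarrow> (int, 'a) kclass \<Rightarrow> 'a vbundle" where
  "kdet X W = foldr (\<lambda>(c, V) D. tensor (line_power (det_bundle V) c) D) W (structure_sheaf X)"

definition mu :: "'a fspace \<Rightarrow> nat \<Rightarrow> 'a vbundle \<Rightarrow> 'a ideals vbundle" where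
  "mu S n L = kdet (hilb S n) (ktaut S n [(1, L), (-1, structure_sheaf S)])"

definition E_bundle :: "'a fspace \<Rightarrow> nat \<Rightarrow> 'a ideals vbundle" where
  "E_bundle S n = det_bundle (taut S n (structure_sheaf S))"

section \<open>Genera\<close>

text \<open>
  The coefficient field is that of Laurent series in the square root of \<open>y\<close>; it contains the
  Laurent polynomials in \<open>y\<close>, and inverses are expanded in powers of \<open>y\<close>.  Power series in \<open>q\<close>
  over it have type \<^typ>\<open>rat fls fps\<close>, and power series in \<open>z\<close> and \<open>q\<close> have type
  \<^typ>\<open>rat fls fps fps\<close>, the outer variable being \<open>z\<close>.
\<close>

definition sqrt_y :: "rat fls" where
  "sqrt_y = fls_X"

definition yvar :: "rat fls" where
  "yvar = sqrt_y ^ 2"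

definition chi_y :: "'a fspace \<Rightarrow> 'a vbundle \<Rightarrow> rat fls" where
  "chi_y M W = sqrt_y powi (- int (vdim M)) *
     (\<Sum>p=0..vdim M. (- yvar) ^ p * of_int (euler_char M (tensor (forms p M) W)))"

text \<open>Power series in \<open>q\<close> with coefficients in K-theory with coefficients.\<close>

type_synonym 'a kseries = "nat \<Rightarrow> (rat fls, 'a) kclass"

definition ks_mult :: "'a kseries \<Rightarrow> 'a kseries \<Rightarrow> 'a kseries" where
  "ks_mult F G = (\<lambda>m. concat (map (\<lambda>a.
     [(c * d, tensor V W). (c, V) \<leftarrow> F a, (d, W) \<leftarrow> G (m - a)]) [0..<Suc m]))"

definition ks_bundle :: "'a vbundle \<Rightarrow> 'a kseries" where
  "ks_bundle V = (\<lambda>m. if m = 0 then [(1, V)] else [])"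

text \<open>The exterior and the symmetric power series at \<open>t = c * q ^ n\<close>, where \<open>n > 0\<close>.\<close>

definition ks_ext :: "rat fls \<Rightarrow> nat \<Rightarrow> 'a vbundle \<Rightarrow> 'a kseries" where
  "ks_ext c n V = (\<lambda>m. if n dvd m \<and> m div n \<le> rank V
     then [(c ^ (m div n), ext_power (m div n) V)] else [])"

definition ks_sym :: "rat fls \<Rightarrow> nat \<Rightarrow> 'a vbundle \<Rightarrow> 'a kseries" where
  "ks_sym c n V = (\<lambda>m. if n dvd m then [(c ^ (m div n), sym_power (m div n) V)] else [])"

definition ell_factor :: "'a vbundle \<Rightarrow> nat \<Rightarrow> 'a kseries" where
  "ell_factor V n = ks_mult (ks_ext (- yvar) n (dual V))
     (ks_mult (ks_ext (- inverse yvar) n V) (ks_sym 1 n (direct_sum V (dual V))))"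

text \<open>Factors with \<open>n > m\<close> do not contribute to the coefficient of \<open>q ^ m\<close> of the product.\<close>

definition ell_class :: "'a vbundle \<Rightarrow> 'a kseries" where
  "ell_class V = (\<lambda>m. foldr (\<lambda>n. ks_mult (ell_factor V n)) [1..<Suc m]
     (ks_bundle (trivial_on (nbhd V))) m)"

definition chi_y_series :: "'a fspace \<Rightarrow> 'a kseries \<Rightarrow> rat fls fps" where
  "chi_y_series M F = Abs_fps (\<lambda>m. \<Sum>(c, V)\<leftarrow>F m. c * chi_y M V)"

definition Ell :: "'a fspace \<Rightarrow> 'a vbundle \<Rightarrow> rat fls fps" where
  "Ell M W = chi_y_series M (ks_mult (ell_class (tangent_bundle M)) (ks_bundle W))"

section \<open>Power series\<close>

definition laurent_poly_y :: "rat fls \<Rightarrow> bool" where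
  "laurent_poly_y g \<longleftrightarrow> finite {k. fls_nth g k \<noteq> 0} \<and> (\<forall>k. fls_nth g k \<noteq> 0 \<longrightarrow> even k)"

definition laurent_poly_series :: "rat fls fps fps \<Rightarrow> bool" where
  "laurent_poly_series A \<longleftrightarrow> (\<forall>i j. laurent_poly_y (fps_nth (fps_nth A i) j))"

definition at_q0 :: "rat fls fps fps \<Rightarrow> rat fls fps" where
  "at_q0 A = Abs_fps (\<lambda>i. fps_nth (fps_nth A i) 0)"

definition rat_to :: "rat \<Rightarrow> 'a :: {comm_ring_1, inverse}" where
  "rat_to a = of_int (fst (quotient_of a)) * inverse (of_int (snd (quotient_of a)))"

text \<open>Rational powers, by the binomial series, of a power series with constant term 1.\<close>

definition rpow :: "'a :: {comm_ring_1, inverse} fps \<Rightarrow> rat \<Rightarrow> 'a fps" where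
  "rpow F a = Abs_fps (\<lambda>k. rat_to (a gchoose k)) oo (F - 1)"

text \<open>The operator \<open>z d/dz log\<close> on power series in \<open>z\<close> with constant term 1.\<close>

definition zdlog :: "'a :: {comm_ring_1, inverse} fps \<Rightarrow> 'a fps" where
  "zdlog F = fps_X * (fps_deriv F / F)"

definition phi_m2_1 :: "rat fls fps" where
  "phi_m2_1 = fps_const ((sqrt_y - inverse sqrt_y) ^ 2) *
     (\<Prod>n. (1 - fps_const yvar * fps_X ^ Suc n) ^ 2 * (1 - fps_const (inverse yvar) * fps_X ^ Suc n) ^ 2
          / (1 - fps_X ^ Suc n) ^ 4)"

definition wp :: "rat fls fps" where
  "wp = Abs_fps (\<lambda>n. if n = 0 then 1 / 12 + 1 / (sqrt_y - inverse sqrt_y) ^ 2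
     else \<Sum>d | d dvd n. of_nat d * (yvar ^ d - 2 + yvar powi (- int d)))"

definition phi_0_1 :: "rat fls fps" where
  "phi_0_1 = 12 * wp * phi_m2_1"

text \<open>The coefficient of \<open>q ^ m * y ^ n\<close>; recall that the variable of \<^typ>\<open>rat fls\<close> is the square
  root of \<open>y\<close>.\<close>

definition coeff_qy :: "rat fls fps \<Rightarrow> nat \<Rightarrow> int \<Rightarrow> rat" where
  "coeff_qy f m n = fls_nth (fps_nth f m) (2 * n)"

text \<open>
  The product of \<open>(1 - z^l q^m y^n)\<close> to the power \<open>w l * c_{lm,n}\<close> over all \<open>l > 0\<close>, \<open>m \<ge> 0\<close>
  and \<open>n\<close>.  Factors with \<open>l > i\<close> or \<open>m > j\<close> do not contribute to the coefficient of \<open>z^i q^j\<close>, and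
  for given \<open>l\<close> and \<open>m\<close> only finitely many exponents are nonzero.
\<close>

definition weighted_lift :: "(nat \<Rightarrow> nat) \<Rightarrow> rat fls fps \<Rightarrow> rat fls fps fps" where
  "weighted_lift w f = Abs_fps (\<lambda>i. Abs_fps (\<lambda>j. fps_nth (fps_nth
     (\<Prod>l=1..i. \<Prod>m=0..j. \<Prod>n | coeff_qy f (l * m) n \<noteq> 0.
        rpow (1 - fps_const (fps_const (yvar powi n) * fps_X ^ m) * fps_X ^ l)
          (of_nat (w l) * coeff_qy f (l * m) n)) i) j))"

definition L_lift :: "rat fls fps \<Rightarrow> rat fls fps fps" where
  "L_lift f = weighted_lift (\<lambda>_. 1) f"

definition L20_lift :: "rat fls fps \<Rightarrow> rat fls fps fps" where
  "L20_lift f = weighted_lift (\<lambda>l. l ^ 2) f"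

definition Delta_tilde :: "rat fls fps" where
  "Delta_tilde = (\<Prod>n. (1 - fps_X ^ Suc n) ^ 20 * (1 - fps_const yvar * fps_X ^ Suc n) ^ 2 *
     (1 - fps_const (inverse yvar) * fps_X ^ Suc n) ^ 2)"

definition theta_factor :: "nat \<Rightarrow> rat fls fps" where
  "theta_factor n = (1 - fps_X ^ n) ^ 2 /
     ((1 - fps_const yvar * fps_X ^ n) * (1 - fps_const (inverse yvar) * fps_X ^ n))"

definition divisor_series :: "rat fls fps" where
  "divisor_series = Abs_fps (\<lambda>n. if n = 0 then 0
     else \<Sum>d | d dvd n. (yvar ^ d - 2 + yvar powi (- int d)) * (of_nat n ^ 3 / of_nat d ^ 3))"

end

theory Submission
  imports Defs
begin

text \<open>
  The statement is the evaluation at \<open>q = 0\<close> of the given formula for elliptic genera.  The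
  twisting class of the elliptic genus is 1 modulo \<open>q\<close>, so the elliptic genus specialises to the
  \<open>\<chi>\<^sub>y\<close> genus (\<open>Ell_nth_0\<close>), while evaluation at \<open>q = 0\<close>, being a ring homomorphism, passes
  through the change of variables, the integral and rational powers, the quotient and the
  logarithmic derivative.

  What remains is to identify the lifts at \<open>q = 0\<close>.  There a lift of \<open>f\<close> depends only on the
  constant term of \<open>f\<close> in \<open>q\<close> (\<open>at_q0_weighted_lift\<close>), which is \<open>y - 2 + 1/y\<close> for
  \<open>\<phi>\<^sub>-\<^sub>2\<^sub>,\<^sub>1\<close> and \<open>y + 10 + 1/y\<close> for \<open>\<phi>\<^sub>0\<^sub>,\<^sub>1\<close>.  The exponents -1, 2, -1 of \<open>-\<phi>\<^sub>-\<^sub>2\<^sub>,\<^sub>1\<close> produce the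
  theta factors, each raised to the power \<open>l^2\<close> (\<open>at_q0_L20_lift_neg\<close>), the exponents 2, 20, 2 of
  \<open>2\<phi>\<^sub>0\<^sub>,\<^sub>1\<close> produce the product \<open>\<Delta>\<close> (\<open>at_q0_L_lift\<close>), and the logarithmic derivative of the
  remaining lift is minus the divisor series (\<open>zdlog_at_q0_L20_lift\<close>).

  The calculus of rational powers and infinite products that this requires rests on two facts.
  The operator \<open>z d/dz log\<close> is an injective homomorphism on power series with constant term 1
  over a field of characteristic 0 (\<open>zdlog_inject\<close>), which reduces the laws of exponents to
  linear algebra.  And every coefficient of the infinite products that occur is already a
  coefficient of a finite subproduct (\<open>prodinf_agree\<close>).
\<close>

section \<open>Congruences between power series and infinite products\<close>

text \<open>
  This is congruence modulo the \<open>n + 1\<close>-st power of the variable.  All infinite products below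
  converge in the sense that the factor with index \<open>n\<close> is congruent to 1 to that order, so that
  every identity between them can be checked on finite subproducts, coefficient by coefficient.
\<close>

definition agree :: "nat \<Rightarrow> 'a fps \<Rightarrow> 'a fps \<Rightarrow> bool" where
  "agree n F G \<longleftrightarrow> (\<forall>k\<le>n. fps_nth F k = fps_nth G k)"

lemma agree_refl [simp]: "agree n F F"
  and agree_sym: "agree n F G \<Longrightarrow> agree n G F"
  and agree_trans [trans]: "agree n F G \<Longrightarrow> agree n G H \<Longrightarrow> agree n F H"
  by (auto simp: agree_def)

lemma agree_mono: "agree n F G \<Longrightarrow> m \<le> n \<Longrightarrow> agree m F G"
  by (auto simp: agree_def)

lemma agree_nth: "agree n F G \<Longrightarrow> k \<le> n \<Longrightarrow> fps_nth F k = fps_nth G k"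
  by (auto simp: agree_def)

lemma agree_eqI: "(\<And>n. agree n F G) \<Longrightarrow> F = G"
  by (auto simp: fps_eq_iff agree_def)

lemma agree_diff:
  fixes F :: "'a :: group_add fps"
  shows "agree n F F' \<Longrightarrow> agree n G G' \<Longrightarrow> agree n (F - G) (F' - G')"
  by (auto simp: agree_def)

lemma agree_mult:
  fixes F :: "'a :: comm_ring_1 fps"
  shows "agree n F F' \<Longrightarrow> agree n G G' \<Longrightarrow> agree n (F * G) (F' * G')"
  by (auto simp: agree_def fps_mult_nth intro!: sum.cong)

lemma agree_power:
  fixes F :: "'a :: comm_ring_1 fps"
  shows "agree n F G \<Longrightarrow> agree n (F ^ m) (G ^ m)"
  by (induction m) (auto intro: agree_mult)

lemma agree_compose:
  fixes F :: "'a :: comm_ring_1 fps"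
  assumes "agree n G H" shows "agree n (F oo G) (F oo H)"
  using agree_power[OF assms] by (auto simp: agree_def fps_compose_nth intro!: sum.cong)

lemma agree_rpow: "agree n F G \<Longrightarrow> agree n (rpow F a) (rpow G a)"
  unfolding rpow_def by (intro agree_compose agree_diff agree_refl)

text \<open>
  Both inverses are obtained by multiplying \<open>inverse F * inverse G\<close> by one of the two congruent
  series.
\<close>

lemma agree_inverse:
  fixes F :: "'a :: field fps"
  assumes "agree n F G" "fps_nth F 0 \<noteq> 0" "fps_nth G 0 \<noteq> 0"
  shows "agree n (inverse F) (inverse G)"
proof -
  have "agree n (inverse F * inverse G * G) (inverse F * inverse G * F)"
    using assms(1) by (intro agree_mult agree_refl) (rule agree_sym)
  moreover have "inverse F * inverse G * G = inverse F" "inverse F * inverse G * F = inverse G"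
    using assms(2,3) inverse_mult_eq_1[of F] inverse_mult_eq_1[of G]
    by (simp_all add: mult.assoc mult.left_commute[of _ "inverse G" F])
  ultimately show ?thesis by simp
qed

text \<open>
  The partial products stabilise coefficientwise.  Their limit has constant term 1, hence is not
  0, and so it qualifies as the value of the infinite product.
\<close>

lemma prodinf_agree:
  fixes F :: "nat \<Rightarrow> 'a :: idom fps"
  assumes F: "\<And>n. agree n (F n) 1"
  shows "agree i (\<Prod>n. F n) (\<Prod>n<i. F n)"
proof -
  define P where "P = Abs_fps (\<lambda>i. fps_nth (\<Prod>n<i. F n) i)"
  have ag: "agree i (\<Prod>n<m. F n) (\<Prod>n<i. F n)" if "i \<le> m" for i m
    using that
  proof (induction m rule: dec_induct)
    case (step m)
    have "agree i ((\<Prod>n<m. F n) * F m) ((\<Prod>n<i. F n) * 1)"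
      by (rule agree_mult[OF step.IH agree_mono[OF F step.hyps(1)]])
    then show ?case by simp
  qed simp
  have P: "agree i P (\<Prod>n<m. F n)" if "i \<le> m" for i m
    unfolding agree_def P_def
  proof (intro allI impI)
    fix k assume "k \<le> i"
    with ag[of k m] that show
      "fps_nth (Abs_fps (\<lambda>i. fps_nth (\<Prod>n<i. F n) i)) k = fps_nth (\<Prod>n<m. F n) k"
      by (simp add: agree_def)
  qed
  have "(\<lambda>N. \<Prod>n\<le>N. F n) \<longlonglongrightarrow> P"
  proof (rule tendsto_fpsI)
    fix k
    show "\<forall>\<^sub>F N in sequentially. fps_nth (\<Prod>n\<le>N. F n) k = fps_nth P k"
      using eventually_ge_at_top[of k]
    proof eventually_elim
      case (elim N)
      then show ?case using P[of k "Suc N"] by (simp add: lessThan_Suc_atMost agree_def)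
    qed
  qed
  moreover have "P \<noteq> 0"
  proof
    assume "P = 0"
    then have "fps_nth P 0 = 0" by simp
    then show False by (simp add: P_def)
  qed
  ultimately have "F has_prod P"
    by (simp add: has_prod_def raw_has_prod_def)
  then have "(\<Prod>n. F n) = P" by (rule has_prod_unique[symmetric])
  with P[of i i] show ?thesis by simp
qed

lemma prodinf_nth_0:
  fixes F :: "nat \<Rightarrow> 'a :: idom fps"
  assumes "\<And>n. agree n (F n) 1"
  shows "fps_nth (\<Prod>n. F n) 0 = 1"
  using prodinf_agree[OF assms, of 0] by (simp add: agree_def)

section \<open>Rational powers and logarithmic derivatives\<close>

lemma rat_to_eq_of_rat: "(rat_to a :: 'a :: field_char_0) = of_rat a"
proof -
  have "a = of_int (fst (quotient_of a)) / of_int (snd (quotient_of a))"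
    by (rule quotient_of_div) simp
  then have "(of_rat a :: 'a) = of_int (fst (quotient_of a)) / of_int (snd (quotient_of a))"
    by (metis of_rat_divide of_rat_of_int_eq)
  then show ?thesis by (simp add: rat_to_def divide_inverse)
qed

lemma of_rat_gbinomial: "(of_rat (a gchoose k) :: 'a :: field_char_0) = of_rat a gchoose k"
proof -
  have "of_rat (fact k) = (fact k :: 'a)"
    by (metis of_nat_fact of_rat_of_nat_eq)
  then show ?thesis
    by (simp add: gbinomial_prod_rev of_rat_divide of_rat_prod of_rat_diff)
qed

lemma rpow_eq_binomial:
  fixes F :: "'a :: field_char_0 fps"
  shows "rpow F a = fps_binomial (of_rat a) oo (F - 1)"
  unfolding rpow_def fps_binomial_def rat_to_eq_of_rat of_rat_gbinomial ..

lemma rpow_nth_0 [simp]: "fps_nth (rpow (F :: 'a :: field_char_0 fps) a) 0 = 1"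
  by (simp add: rpow_eq_binomial)

lemma zdlog_eq:
  fixes F :: "'a :: field fps"
  shows "fps_nth F 0 = 1 \<Longrightarrow> zdlog F = fps_X * fps_deriv F * inverse F"
  by (simp add: zdlog_def fps_divide_unit mult.assoc)

lemma zdlog_eqI:
  fixes F :: "'a :: field fps"
  assumes "fps_nth F 0 = 1" "D * F = fps_X * fps_deriv F"
  shows "zdlog F = D"
  using assms inverse_mult_eq_1'[of F] by (simp add: zdlog_eq mult.assoc flip: assms(2))

lemma zdlog_times:
  fixes F :: "'a :: field fps"
  assumes "fps_nth F 0 = 1"
  shows "zdlog F * F = fps_X * fps_deriv F"
  using assms inverse_mult_eq_1[of F] by (simp add: zdlog_eq mult.assoc)

lemma zdlog_mult:
  fixes F G :: "'a :: field fps"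
  assumes "fps_nth F 0 = 1" "fps_nth G 0 = 1"
  shows "zdlog (F * G) = zdlog F + zdlog G"
proof (rule zdlog_eqI)
  have "(zdlog F + zdlog G) * (F * G) = (zdlog F * F) * G + F * (zdlog G * G)"
    by (simp add: algebra_simps)
  also have "\<dots> = fps_X * fps_deriv (F * G)"
    unfolding zdlog_times[OF assms(1)] zdlog_times[OF assms(2)] by (simp add: algebra_simps)
  finally show "(zdlog F + zdlog G) * (F * G) = fps_X * fps_deriv (F * G)" .
qed (use assms in simp)

lemma zdlog_one [simp]: "zdlog (1 :: 'a :: field fps) = 0"
  by (simp add: zdlog_eq)

lemma zdlog_prod:
  fixes F :: "'b \<Rightarrow> 'a :: field fps"
  assumes "\<And>x. x \<in> S \<Longrightarrow> fps_nth (F x) 0 = 1"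
  shows "fps_nth (prod F S) 0 = 1 \<and> zdlog (prod F S) = (\<Sum>x\<in>S. zdlog (F x))"
  using assms by (induction S rule: infinite_finite_induct) (auto simp: zdlog_mult)

text \<open>
  The binomial series \<open>b\<close> with exponent \<open>a\<close> solves \<open>(1 + x) * b' = a * b\<close>; substituting
  \<open>F - 1\<close> for \<open>x\<close> and using the chain rule gives the claim.
\<close>

lemma zdlog_rpow:
  fixes F :: "'a :: field_char_0 fps"
  assumes "fps_nth F 0 = 1"
  shows "zdlog (rpow F a) = fps_const (of_rat a) * zdlog F"
proof (rule zdlog_eqI)
  let ?b = "fps_binomial (of_rat a) :: 'a fps"
  have "(1 + fps_X) * fps_deriv ?b = fps_const (of_rat a) * ?b"
    using inverse_mult_eq_1'[of "1 + fps_X :: 'a fps"]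
    by (simp add: fps_binomial_deriv fps_divide_unit mult.left_commute[of "1 + fps_X"])
  then have "((1 + fps_X) * fps_deriv ?b) oo (F - 1) = (fps_const (of_rat a) * ?b) oo (F - 1)"
    by simp
  then have "F * (fps_deriv ?b oo (F - 1)) = fps_const (of_rat a) * rpow F a"
    using assms by (simp add: fps_compose_mult_distrib fps_compose_add_distrib rpow_eq_binomial)
  then have *: "fps_const (of_rat a) * rpow F a * fps_deriv F = F * fps_deriv (rpow F a)"
    using assms by (simp add: rpow_eq_binomial fps_compose_deriv mult.assoc)
  have "F * (fps_const (of_rat a) * zdlog F * rpow F a) =
      fps_const (of_rat a) * rpow F a * (zdlog F * F)"
    by (simp add: algebra_simps)
  also have "\<dots> = fps_X * (fps_const (of_rat a) * rpow F a * fps_deriv F)"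
    unfolding zdlog_times[OF assms] by (simp add: algebra_simps)
  also have "\<dots> = F * (fps_X * fps_deriv (rpow F a))"
    unfolding * by (simp add: algebra_simps)
  finally show "fps_const (of_rat a) * zdlog F * rpow F a = fps_X * fps_deriv (rpow F a)"
    using assms by (metis fps_nonzeroI mult_left_cancel zero_neq_one)
qed simp

text \<open>
  If the logarithmic derivatives agree, then \<open>F / G\<close> has derivative 0 and hence, in
  characteristic 0, is constant.  Thus \<^const>\<open>zdlog\<close> embeds the multiplicative group of series
  with constant term 1 into the additive group, turning rational powers into scalar multiples;
  the laws of exponents that follow are obtained by comparing images under this embedding.
\<close>

lemma zdlog_inject:
  fixes F G :: "'a :: field_char_0 fps"
  assumes "fps_nth F 0 = 1" "fps_nth G 0 = 1" "zdlog F = zdlog G"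
  shows "F = G"
proof -
  have nz: "fps_X \<noteq> (0 :: 'a fps)" by simp
  have "fps_X * (fps_deriv F * G) = (zdlog F * F) * G"
    by (simp add: zdlog_times[OF assms(1)] mult.assoc)
  also have "\<dots> = F * (zdlog G * G)"
    by (simp add: assms(3) ac_simps)
  also have "\<dots> = fps_X * (F * fps_deriv G)"
    unfolding zdlog_times[OF assms(2)] by (simp add: ac_simps)
  finally have eq: "fps_deriv F * G = F * fps_deriv G"
    using nz by (metis mult_left_cancel)
  have G: "G * inverse G = 1" using assms(2) by (simp add: inverse_mult_eq_1')
  have "fps_deriv (F * inverse G) = (fps_deriv F * G - F * fps_deriv G) * inverse G ^ 2"
    using assms(2) G by (simp add: fps_inverse_deriv algebra_simps power2_eq_square)
  then have "fps_deriv (F * inverse G) = 0" by (simp add: eq)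
  then have "F * inverse G = fps_const (fps_nth (F * inverse G) 0)"
    by (simp only: fps_deriv_eq_0_iff)
  then have "F * inverse G = 1" using assms by simp
  then have "F * (G * inverse G) = G" by (simp add: ac_simps)
  then show ?thesis by (simp add: G)
qed

lemma rpow_mult:
  fixes F G :: "'a :: field_char_0 fps"
  assumes "fps_nth F 0 = 1" "fps_nth G 0 = 1"
  shows "rpow (F * G) a = rpow F a * rpow G a"
  by (rule zdlog_inject) (use assms in \<open>simp_all add: zdlog_rpow zdlog_mult distrib_left\<close>)

lemma rpow_rpow:
  fixes F :: "'a :: field_char_0 fps"
  assumes "fps_nth F 0 = 1"
  shows "rpow (rpow F a) b = rpow F (a * b)"
  by (rule zdlog_inject)
    (use assms in \<open>simp_all add: zdlog_rpow of_rat_mult mult_ac flip: fps_const_mult\<close>)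

lemma rpow_of_nat:
  fixes F :: "'a :: field_char_0 fps"
  assumes "fps_nth F 0 = 1"
  shows "rpow F (of_nat n) = F ^ n"
proof (rule zdlog_inject)
  have "fps_nth (F ^ n) 0 = 1 \<and> zdlog (F ^ n) = of_nat n * zdlog F"
    using zdlog_prod[of "{..<n}" "\<lambda>_. F"] assms by simp
  then show "fps_nth (F ^ n) 0 = 1" "zdlog (rpow F (of_nat n)) = zdlog (F ^ n)"
    using assms by (simp_all add: zdlog_rpow fps_of_nat)
qed simp

lemma rpow_0 [simp]: "rpow (F :: 'a :: field_char_0 fps) 0 = 1"
  by (simp add: rpow_eq_binomial)

lemma rpow_add:
  fixes F :: "'a :: field_char_0 fps"
  assumes "fps_nth F 0 = 1"
  shows "rpow F (a + b) = rpow F a * rpow F b"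
  by (rule zdlog_inject)
    (use assms in \<open>simp_all add: zdlog_rpow zdlog_mult of_rat_add distrib_right flip: fps_const_add\<close>)

lemma rpow_minus_one:
  fixes F :: "'a :: field_char_0 fps"
  assumes "fps_nth F 0 = 1"
  shows "rpow F (- 1) = inverse F"
proof -
  have "rpow F (- 1) * F = 1"
    using rpow_add[OF assms, of "- 1" 1] rpow_of_nat[OF assms, of 1] by simp
  then have "rpow F (- 1) * (F * inverse F) = inverse F"
    by (simp flip: mult.assoc)
  then show ?thesis using assms by (simp add: inverse_mult_eq_1')
qed

lemma rpow_one [simp]: "rpow (1 :: 'a :: field_char_0 fps) a = 1"
  by (rule zdlog_inject) (simp_all add: zdlog_rpow)

lemma rpow_agree_one:
  fixes F :: "'a :: field_char_0 fps"
  shows "agree n F 1 \<Longrightarrow> agree n (rpow F a) 1"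
  using agree_rpow[of n F 1 a] by simp

lemma rpow_prod:
  fixes F :: "'b \<Rightarrow> 'a :: field_char_0 fps"
  assumes "\<And>x. x \<in> S \<Longrightarrow> fps_nth (F x) 0 = 1"
  shows "rpow (prod F S) a = (\<Prod>x\<in>S. rpow (F x) a)"
  by (rule zdlog_inject)
    (use assms zdlog_prod[of S F] zdlog_prod[of S "\<lambda>x. rpow (F x) a"] in
      \<open>simp_all add: zdlog_rpow sum_distrib_left\<close>)

lemma rpow_prodinf:
  fixes F :: "nat \<Rightarrow> 'a :: field_char_0 fps"
  assumes F: "\<And>n. agree n (F n) 1"
  shows "rpow (\<Prod>n. F n) a = (\<Prod>n. rpow (F n) a)"
proof (rule agree_eqI)
  fix i
  have "agree i (rpow (\<Prod>n. F n) a) (rpow (\<Prod>n<i. F n) a)"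
    by (rule agree_rpow[OF prodinf_agree[OF F]])
  also have "rpow (\<Prod>n<i. F n) a = (\<Prod>n<i. rpow (F n) a)"
    using agree_nth[OF F] by (intro rpow_prod) simp
  also have "agree i \<dots> (\<Prod>n. rpow (F n) a)"
    by (rule agree_sym[OF prodinf_agree]) (rule rpow_agree_one[OF F])
  finally show "agree i (rpow (\<Prod>n. F n) a) (\<Prod>n. rpow (F n) a)" .
qed

lemma zdlog_agree:
  fixes F G :: "'a :: field fps"
  assumes "agree n F G" "fps_nth F 0 = 1" "fps_nth G 0 = 1"
  shows "agree n (zdlog F) (zdlog G)"
proof -
  have *: "agree n (fps_X * fps_deriv F) (fps_X * fps_deriv G)"
    using assms(1) by (auto simp: agree_def)
  show ?thesis
    unfolding zdlog_eq[OF assms(2)] zdlog_eq[OF assms(3)]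
    by (intro agree_mult[OF *] agree_inverse assms(1)) (simp_all add: assms)
qed

lemma zdlog_prodinf_nth:
  fixes F :: "nat \<Rightarrow> 'a :: field fps"
  assumes F: "\<And>n. agree n (F n) 1"
  shows "fps_nth (zdlog (\<Prod>n. F n)) i = (\<Sum>n<i. fps_nth (zdlog (F n)) i)"
proof -
  have F0: "fps_nth (F n) 0 = 1" for n using agree_nth[OF F, of 0] by simp
  note * = zdlog_prod[of "{..<i}" F, OF F0]
  have "agree i (zdlog (\<Prod>n. F n)) (zdlog (\<Prod>n<i. F n))"
    using * by (intro zdlog_agree prodinf_agree F prodinf_nth_0) simp
  then show ?thesis using * by (simp add: agree_def fps_sum_nth)
qed

text \<open>
  The geometric series for \<open>- l * c * X^l / (1 - c * X^l)\<close>, verified by multiplying with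
  \<open>1 - c * X^l\<close>.
\<close>

lemma zdlog_one_minus_nth:
  fixes c :: "'a :: field"
  assumes "0 < l"
  shows "fps_nth (zdlog (1 - fps_const c * fps_X ^ l)) i =
    (if l dvd i \<and> 0 < i then - (of_nat l * c ^ (i div l)) else 0)"
proof -
  let ?F = "1 - fps_const c * fps_X ^ l"
  define D where "D = Abs_fps (\<lambda>i. if l dvd i \<and> 0 < i then - (of_nat l * c ^ (i div l)) else 0)"
  have "zdlog ?F = D"
  proof (rule zdlog_eqI)
    show "fps_nth ?F 0 = 1" using assms by simp
    have eq: "D * ?F = D - fps_const c * (D * fps_X ^ l)"
      by (simp add: algebra_simps)
    show "D * ?F = fps_X * fps_deriv ?F"
    proof (rule fps_ext)
      fix i
      have R: "fps_nth (fps_X * fps_deriv ?F) i = (if i = l then - (of_nat l * c) else 0)"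
        using assms by (cases i) (auto simp: fps_X_power_nth simp del: of_nat_Suc)
      have "i div l = Suc ((i - l) div l)" if "l \<le> i"
        using that assms by (simp add: le_div_geq)
      moreover have "l dvd i - l \<longleftrightarrow> l dvd i" if "l \<le> i"
        using that by (metis dvd_minus_self linorder_not_less)
      ultimately have L: "fps_nth (D * ?F) i = (if i = l then - (of_nat l * c) else 0)"
        unfolding eq using assms
        by (auto simp: D_def fps_X_power_mult_right_nth dest: dvd_imp_le)
      show "fps_nth (D * ?F) i = fps_nth (fps_X * fps_deriv ?F) i"
        by (simp only: L R)
    qed
  qed
  then show ?thesis by (simp add: D_def)
qed

section \<open>Evaluation at \<open>q = 0\<close>\<close>

text \<open>
  Evaluation at \<open>q = 0\<close> is a ring homomorphism on the coefficients of a power series in \<open>z\<close>.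
  It therefore commutes with every construction whose coefficients in \<open>z\<close> are given by finitely
  many ring operations: this covers substitution, rational powers and derivatives.
\<close>

lemma at_q0_nth [simp]: "fps_nth (at_q0 F) n = fps_nth (fps_nth F n) 0"
  by (simp add: at_q0_def)

lemma at_q0_one [simp]: "at_q0 1 = 1"
  by (rule fps_ext) simp

lemma at_q0_X [simp]: "at_q0 fps_X = fps_X"
  by (rule fps_ext) simp

lemma at_q0_const [simp]: "at_q0 (fps_const c) = fps_const (fps_nth c 0)"
  by (rule fps_ext) simp

lemma at_q0_diff [simp]: "at_q0 (F - G) = at_q0 F - at_q0 G"
  by (rule fps_ext) simp

lemma at_q0_mult [simp]: "at_q0 (F * G) = at_q0 F * at_q0 G"
  by (rule fps_ext) (simp add: fps_mult_nth fps_sum_nth)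

lemma at_q0_power [simp]: "at_q0 (F ^ n) = at_q0 F ^ n"
  by (induction n) simp_all

lemma at_q0_prod [simp]: "at_q0 (prod F S) = (\<Prod>x\<in>S. at_q0 (F x))"
  by (induction S rule: infinite_finite_induct) simp_all

lemma at_q0_of_int [simp]: "at_q0 (of_int n) = of_int n"
  by (simp flip: fps_of_int)

lemma at_q0_deriv [simp]: "at_q0 (fps_deriv F) = fps_deriv (at_q0 F)"
  by (rule fps_ext) (simp flip: fps_of_nat add: fps_mult_nth)

lemma at_q0_compose [simp]: "at_q0 (F oo G) = at_q0 F oo at_q0 G"
  by (rule fps_ext) (simp add: fps_compose_nth fps_sum_nth flip: at_q0_power)

text \<open>
  The coefficients of an inverse satisfy a recursion that uses ring operations and the inverse of
  the constant term only, and all of these commute with evaluation at \<open>q = 0\<close>.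
\<close>

lemma at_q0_inverse [simp]: "at_q0 (inverse F) = inverse (at_q0 F)"
proof (rule fps_ext)
  fix n
  have "fps_nth (natfun_inverse F n) 0 = natfun_inverse (at_q0 F) n"
  proof (induction n rule: less_induct)
    case (less n)
    show ?case
    proof (cases n)
      case (Suc m)
      then show ?thesis
        using less.IH by (simp add: fps_sum_nth)
    qed simp
  qed
  then show "fps_nth (at_q0 (inverse F)) n = fps_nth (inverse (at_q0 F)) n"
    by (simp add: fps_inverse_def)
qed

lemma at_q0_powi [simp]: "at_q0 (F powi n) = at_q0 F powi n"
  by (simp add: power_int_def)

lemma at_q0_divide: "fps_nth G 0 = 1 \<Longrightarrow> at_q0 (F / G) = at_q0 F / at_q0 G"
  by (simp add: fps_divide_unit' fps_divide_unit subdegree_eq_0_iff)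

lemma at_q0_zdlog: "fps_nth F 0 = 1 \<Longrightarrow> at_q0 (zdlog F) = zdlog (at_q0 F)"
  by (simp add: zdlog_def at_q0_divide)

lemma rat_to_fps_nth_0: "fps_nth (rat_to a :: rat fls fps) 0 = rat_to a"
  by (simp add: rat_to_def)

lemma at_q0_rpow [simp]: "at_q0 (rpow F a) = rpow (at_q0 F) a"
proof -
  have "at_q0 (Abs_fps (\<lambda>k. rat_to (a gchoose k))) = Abs_fps (\<lambda>k. rat_to (a gchoose k))"
    by (rule fps_ext) (simp add: rat_to_fps_nth_0)
  then show ?thesis by (simp add: rpow_def)
qed

lemma rpow_nth_0_nested: "fps_nth (rpow (F :: rat fls fps fps) a) 0 = 1"
  by (simp add: rpow_def rat_to_def)

section \<open>The elliptic genus at \<open>q = 0\<close>\<close>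

lemma kronecker_one: "kronecker (1\<^sub>m 1) A = A"
  by (rule eq_matI) (auto simp: kronecker_def)

text \<open>
  The two sides are the same bundle, not merely isomorphic ones: the trivial bundle is given on
  the neighbourhoods of \<^term>\<open>F\<close>, so that in a product with \<^term>\<open>F\<close> it changes neither the cover
  nor the transition matrices.
\<close>

lemma tensor_trivial_on:
  assumes "nbhd F = U"
  shows "tensor F (tensor (trivial_on U) W) = tensor F W"
  using assms by (auto simp: tensor_def trivial_on_def kronecker_one simp del: One_nat_def)

lemma chi_y_tensor_trivial:
  "chi_y M (tensor (trivial_on (nbhd (tangent_bundle M))) W) = chi_y M W"
proof -
  have "nbhd (forms p M) = nbhd (tangent_bundle M)" for p
    by (simp add: forms_def ext_power_def dual_def Let_def)
  then show ?thesis by (simp add: chi_y_def tensor_trivial_on)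
qed

text \<open>
  The class with which the elliptic genus is twisted has constant term in \<open>q\<close> the class of the
  trivial bundle on the cover of the tangent bundle, which is also the cover of the bundles of
  forms.
\<close>

lemma Ell_nth_0: "fps_nth (Ell M W) 0 = chi_y M W"
  by (simp add: Ell_def chi_y_series_def ks_mult_def ell_class_def ks_bundle_def
      chi_y_tensor_trivial)

section \<open>The lifts at \<open>q = 0\<close>\<close>

abbreviation binom_factor :: "'a :: field \<Rightarrow> nat \<Rightarrow> 'a fps" where
  "binom_factor c l \<equiv> 1 - fps_const c * fps_X ^ l"

lemma one_minus_X_power: "1 - fps_X ^ l = binom_factor 1 l"
  by simp

lemma agree_one_binom_factor: "agree n (binom_factor c (Suc n)) 1"
  by (simp add: agree_def del: power_Suc)

lemma agree_one_mult:
  fixes F :: "'a :: comm_ring_1 fps"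
  shows "agree n F 1 \<Longrightarrow> agree n G 1 \<Longrightarrow> agree n (F * G) 1"
  using agree_mult[of n F 1 G 1] by simp

lemma agree_one_power:
  fixes F :: "'a :: comm_ring_1 fps"
  shows "agree n F 1 \<Longrightarrow> agree n (F ^ m) 1"
  using agree_power[of n F 1] by simp

lemma agree_one_divide:
  fixes F :: "'a :: field fps"
  assumes "agree n F 1" "agree n G 1" shows "agree n (F / G) 1"
proof -
  have "fps_nth G 0 = 1" using agree_nth[OF assms(2), of 0] by simp
  then show ?thesis
    using agree_mult[OF assms(1) agree_inverse[OF assms(2)]] by (simp add: fps_divide_unit)
qed

lemmas agree_one_intros =
  agree_one_binom_factor agree_one_mult agree_one_power agree_one_divide rpow_agree_one

lemma yvar_neq_0 [simp]: "yvar \<noteq> 0" and sqrt_y_neq_0 [simp]: "sqrt_y \<noteq> 0"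
  by (simp_all add: yvar_def sqrt_y_def)

text \<open>
  All three Jacobi forms in question have a constant term in \<open>q\<close> of the form
  \<open>a * (y + 1 / y) + b\<close>.
\<close>

lemma coeff_qy_0:
  assumes "fps_nth f 0 = fls_const a * (yvar + inverse yvar) + fls_const b"
  shows "coeff_qy f 0 n = (if n = 1 \<or> n = - 1 then a else if n = 0 then b else 0)"
proof -
  have y: "yvar = fls_shift (- 2) 1"
    by (simp add: yvar_def sqrt_y_def fls_X_power_conv_shift_1)
  have "yvar * fls_shift 2 1 = 1"
    unfolding y by (simp add: fls_shifted_times_simps)
  then have "inverse yvar = fls_shift 2 1"
    by (rule inverse_unique)
  then show ?thesis
    unfolding coeff_qy_def assms by (auto simp: y)
qed

text \<open>
  Only the factors with \<open>m = 0\<close> survive, and their exponents are given by the constant term of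
  \<^term>\<open>f\<close> in \<open>q\<close>.  Hence the lift becomes a product over \<open>l > 0\<close> of three binomial factors,
  which belong to the exponents 0, 1 and -1 of \<open>y\<close>.
\<close>

lemma at_q0_weighted_lift:
  assumes f: "fps_nth f 0 = fls_const a * (yvar + inverse yvar) + fls_const b"
  shows "at_q0 (weighted_lift w f) =
    (\<Prod>k. rpow (binom_factor 1 (Suc k)) (of_nat (w (Suc k)) * b) *
      (rpow (binom_factor yvar (Suc k)) (of_nat (w (Suc k)) * a) *
       rpow (binom_factor (inverse yvar) (Suc k)) (of_nat (w (Suc k)) * a)))"
    (is "_ = (\<Prod>k. ?H (Suc k))")
proof (rule fps_ext)
  fix i
  let ?G = "\<lambda>l n. rpow (binom_factor (yvar powi n) l) (of_nat (w l) * coeff_qy f 0 n)"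
  have H: "(\<Prod>n | coeff_qy f 0 n \<noteq> 0. ?G l n) = ?H l" for l
  proof -
    have "(\<Prod>n | coeff_qy f 0 n \<noteq> 0. ?G l n) = (\<Prod>n\<in>{0, 1, - 1}. ?G l n)"
      by (rule prod.mono_neutral_left) (auto simp: coeff_qy_0[OF f] split: if_splits)
    then show ?thesis by (simp add: coeff_qy_0[OF f])
  qed
  have "fps_nth (at_q0 (weighted_lift w f)) i =
    fps_nth (at_q0 (\<Prod>l=1..i. \<Prod>m=0..0. \<Prod>n | coeff_qy f (l * m) n \<noteq> 0.
        rpow (1 - fps_const (fps_const (yvar powi n) * fps_X ^ m) * fps_X ^ l)
          (of_nat (w l) * coeff_qy f (l * m) n))) i"
    by (simp only: at_q0_nth weighted_lift_def fps_nth_Abs_fps)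
  also have "\<dots> = fps_nth (\<Prod>l=1..i. ?H l) i"
    by (simp add: H)
  also have "(\<Prod>l=1..i. ?H l) = (\<Prod>k<i. ?H (Suc k))"
    by (simp only: One_nat_def prod.atLeast1_atMost_eq)
  also have "fps_nth \<dots> i = fps_nth (\<Prod>k. ?H (Suc k)) i"
    by (rule agree_nth[OF agree_sym[OF prodinf_agree]]) (intro agree_one_intros order.refl)+
  finally show "fps_nth (at_q0 (weighted_lift w f)) i = fps_nth (\<Prod>k. ?H (Suc k)) i" .
qed

lemma L20_lift_nth_0 [simp]: "fps_nth (L20_lift f) 0 = 1"
  unfolding L20_lift_def by (rule fps_ext) (simp add: weighted_lift_def)

lemma theta_factor_eq:
  "theta_factor l = binom_factor 1 l ^ 2 / (binom_factor yvar l * binom_factor (inverse yvar) l)"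
  unfolding theta_factor_def one_minus_X_power ..

lemma agree_one_theta_factor: "agree n (theta_factor (Suc n)) 1"
  unfolding theta_factor_eq by (intro agree_one_intros)

text \<open>
  The exponents 2, -1, -1 in a theta factor are, up to sign, the coefficients of
  \<open>y - 2 + 1/y\<close>; in this form theta factors can be matched with the factors of a lift.
\<close>

lemma rpow_theta_factor:
  assumes "0 < l"
  shows "rpow (theta_factor l) a =
    rpow (binom_factor 1 l) (2 * a) *
      (rpow (binom_factor yvar l) (- a) * rpow (binom_factor (inverse yvar) l) (- a))"
proof -
  have n0: "fps_nth (binom_factor c l) 0 = 1" for c :: "rat fls"
    using assms by simp
  have "theta_factor l = rpow (binom_factor 1 l) 2 *
      (rpow (binom_factor yvar l) (- 1) * rpow (binom_factor (inverse yvar) l) (- 1))"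
    unfolding theta_factor_eq
    using rpow_of_nat[OF n0[of 1], of 2] rpow_minus_one[OF n0[of yvar]]
      rpow_minus_one[OF n0[of "inverse yvar"]] assms
    by (simp add: fps_divide_unit fps_inverse_mult)
  then show ?thesis
    using assms by (simp add: rpow_mult rpow_rpow)
qed

lemma zdlog_theta_factor_nth:
  assumes "0 < l"
  shows "fps_nth (zdlog (theta_factor l)) i =
    (if l dvd i \<and> 0 < i then of_nat l * (yvar ^ (i div l) - 2 + inverse yvar ^ (i div l)) else 0)"
proof -
  have "theta_factor l = rpow (theta_factor l) 1"
  proof -
    have "fps_nth (theta_factor l) 0 = 1"
      using assms agree_nth[OF agree_one_theta_factor[of "l - 1"], of 0] by simp
    from rpow_of_nat[OF this, of 1] show ?thesis by simp
  qed
  then have "zdlog (theta_factor l) = fps_const 2 * zdlog (binom_factor 1 l)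
      - (zdlog (binom_factor yvar l) + zdlog (binom_factor (inverse yvar) l))"
    unfolding rpow_theta_factor[OF assms]
    using assms by (simp add: zdlog_mult zdlog_rpow flip: fps_const_neg)
  then show ?thesis
    by (simp only: fps_sub_nth fps_add_nth fps_mult_left_const_nth zdlog_one_minus_nth[OF assms])
      (simp add: algebra_simps)
qed

lemma sqrt_y_diff_square: "(sqrt_y - inverse sqrt_y) ^ 2 = yvar - 2 + inverse yvar"
  by (simp add: yvar_def power2_eq_square algebra_simps)

lemma sqrt_y_diff_neq_0: "sqrt_y - inverse sqrt_y \<noteq> 0"
proof
  assume "sqrt_y - inverse sqrt_y = 0"
  then have "sqrt_y ^ 2 = 1" by (simp add: power2_eq_square) (metis sqrt_y_neq_0 right_inverse)
  then have "fls_nth (sqrt_y ^ 2) 2 = fls_nth 1 2" by simp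
  then show False by (simp add: sqrt_y_def fls_X_power_conv_shift_1)
qed

lemma phi_m2_1_nth_0: "fps_nth phi_m2_1 0 = yvar - 2 + inverse yvar"
proof -
  have "fps_nth (\<Prod>n. (1 - fps_const yvar * fps_X ^ Suc n) ^ 2 *
          (1 - fps_const (inverse yvar) * fps_X ^ Suc n) ^ 2 / (1 - fps_X ^ Suc n) ^ 4) 0 = 1"
    unfolding one_minus_X_power by (intro prodinf_nth_0 agree_one_intros)
  then show ?thesis
    unfolding phi_m2_1_def by (simp only: fps_mult_nth_0 fps_nth_fps_const sqrt_y_diff_square) simp
qed

text \<open>
  The pole of the Weierstrass function at \<open>y = 1\<close> cancels against the double zero of the other
  factor.
\<close>

lemma phi_0_1_nth_0: "fps_nth phi_0_1 0 = yvar + 10 + inverse yvar"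
proof -
  let ?t = "(sqrt_y - inverse sqrt_y) ^ 2"
  have "fps_nth phi_0_1 0 = 12 * (1 / 12 + 1 / ?t) * ?t"
    by (simp add: phi_0_1_def wp_def phi_m2_1_nth_0 sqrt_y_diff_square)
  also have "\<dots> = ?t + 12"
    using sqrt_y_diff_neq_0 by (simp add: field_simps)
  finally show ?thesis by (simp add: sqrt_y_diff_square)
qed

lemma at_q0_L20_lift_neg:
  "at_q0 (L20_lift (- phi_m2_1)) = (\<Prod>k. rpow (theta_factor (Suc k)) (of_nat (Suc k) ^ 2))"
proof -
  have "fps_nth (- phi_m2_1) 0 = fls_const (- 1) * (yvar + inverse yvar) + fls_const 2"
    by (simp add: phi_m2_1_nth_0 fls_const_numeral)
  from at_q0_weighted_lift[OF this] show ?thesis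
    by (simp add: L20_lift_def rpow_theta_factor mult.commute)
qed

lemma at_q0_L20_lift:
  "at_q0 (L20_lift phi_m2_1) = (\<Prod>k. rpow (theta_factor (Suc k)) (- (of_nat (Suc k) ^ 2)))"
proof -
  have "fps_nth phi_m2_1 0 = fls_const 1 * (yvar + inverse yvar) + fls_const (- 2)"
    by (simp add: phi_m2_1_nth_0 fls_const_numeral)
  from at_q0_weighted_lift[OF this] show ?thesis
    by (simp add: L20_lift_def rpow_theta_factor mult.commute)
qed

lemma at_q0_L_lift: "at_q0 (L_lift (2 * phi_0_1)) = Delta_tilde"
proof -
  have "fps_nth (2 * phi_0_1) 0 = fls_const 2 * (yvar + inverse yvar) + fls_const 20"
    by (simp add: phi_0_1_nth_0 fls_const_numeral)
  note * = at_q0_weighted_lift[OF this, of "\<lambda>_. 1"]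
  have r: "rpow (binom_factor c (Suc k)) (numeral n) = binom_factor c (Suc k) ^ numeral n"
    for c :: "rat fls" and k n
    using rpow_of_nat[of "binom_factor c (Suc k)" "numeral n"] by simp
  show ?thesis
    unfolding L_lift_def * Delta_tilde_def one_minus_X_power
    by (simp only: r of_nat_1 mult_1_left mult.assoc)
qed

text \<open>
  The factor with index \<open>l\<close> contributes to the coefficient of \<open>z^i\<close> if \<open>i = l * d\<close> for some
  \<open>d\<close>, and its contribution is \<open>- l^3 * (y^d - 2 + y^(-d))\<close>: two powers of \<open>l\<close> come from the
  exponent in the lift and one from the logarithmic derivative.  As \<open>l = i / d\<close>, summation over
  the complementary divisor \<open>d\<close> yields the divisor series.
\<close>

lemma zdlog_at_q0_L20_lift: "zdlog (at_q0 (L20_lift phi_m2_1)) = - divisor_series"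
proof (rule fps_ext)
  fix i
  define c where "c d = yvar ^ d - 2 + inverse yvar ^ d" for d
  have t0: "fps_nth (theta_factor (Suc k)) 0 = 1" for k
    using agree_nth[OF agree_one_theta_factor, of 0] by simp
  have "fps_nth (zdlog (at_q0 (L20_lift phi_m2_1))) i =
    (\<Sum>k<i. fps_nth (zdlog (rpow (theta_factor (Suc k)) (- (of_nat (Suc k) ^ 2)))) i)"
    unfolding at_q0_L20_lift
    by (intro zdlog_prodinf_nth rpow_agree_one agree_one_theta_factor)
  also have "\<dots> = (\<Sum>k<i. if Suc k dvd i then - (of_nat (Suc k) ^ 3 * c (i div Suc k)) else 0)"
    by (rule sum.cong)
      (auto simp: zdlog_rpow t0 zdlog_theta_factor_nth c_def of_rat_minus of_rat_mult
        power2_eq_square power3_eq_cube mult.assoc simp del: of_nat_Suc)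
  also have "\<dots> = (\<Sum>l=1..i. if l dvd i then - (of_nat l ^ 3 * c (i div l)) else 0)"
    by (simp only: One_nat_def sum.atLeast1_atMost_eq)
  also have "\<dots> = - (\<Sum>l | l \<in> {1..i} \<and> l dvd i. of_nat l ^ 3 * c (i div l))"
    by (simp add: sum_negf flip: sum.inter_filter)
  also have "\<dots> = - fps_nth divisor_series i"
  proof (cases "i = 0")
    case False
    have "(\<Sum>l | l \<in> {1..i} \<and> l dvd i. of_nat l ^ 3 * c (i div l)) =
      (\<Sum>d | d dvd i. c d * (of_nat i ^ 3 / of_nat d ^ 3))"
    proof (rule sum.reindex_bij_witness[of _ "\<lambda>d. i div d" "\<lambda>l. i div l"])
      fix l assume "l \<in> {l. l \<in> {1..i} \<and> l dvd i}"
      then obtain d where d: "i = l * d" "0 < l" by auto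
      with False show
        "c (i div l) * (of_nat i ^ 3 / of_nat (i div l) ^ 3) = of_nat l ^ 3 * c (i div l)"
        by (simp add: power_mult_distrib)
    qed (use False in \<open>auto simp: dvd_div_eq_0_iff dvd_imp_le Suc_le_eq div_greater_zero_iff
        dest: dvd_imp_le\<close>)
    then show ?thesis using False
      by (simp add: divisor_series_def c_def power_int_minus power_inverse)
  qed (simp add: divisor_series_def)
  finally show "fps_nth (zdlog (at_q0 (L20_lift phi_m2_1))) i = fps_nth (- divisor_series) i"
    by simp
qed

section \<open>The generating series of twisted \<open>\<chi>\<^sub>y\<close> genera\<close>

theorem corollary1p4:
  fixes r :: int and A B :: "rat fls fps fps"
  assumes "laurent_poly_series A" and "laurent_poly_series B"
    and "\<And>S L. smooth_projective_surface S \<Longrightarrow> is_line_bundle S L \<Longrightarrow>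
      Abs_fps (\<lambda>n. Ell (hilb S n) (tensor (mu S n L) (line_power (E_bundle S n) r)))
        oo (fps_X * L20_lift (- phi_m2_1) ^ nat (r ^ 2)) =
      rpow (L20_lift (- phi_m2_1))
          (1 / 2 * of_int (intersection S L L + r ^ 2 * euler_char S (structure_sheaf S)))
        * A powi (intersection S L (canonical_bundle S))
        * B powi (intersection S (canonical_bundle S) (canonical_bundle S))
        / rpow (L_lift (2 * phi_0_1) * (1 - of_int (r ^ 2) * zdlog (L20_lift phi_m2_1)))
            (of_int (euler_char S (structure_sheaf S)) / 2)"
    and "smooth_projective_surface S" and "is_line_bundle S L"
  shows
    "Abs_fps (\<lambda>n. chi_y (hilb S n) (tensor (mu S n L) (line_power (E_bundle S n) r)))
       oo (fps_X * (\<Prod>n. theta_factor (Suc n) ^ (Suc n ^ 2 * nat (r ^ 2)))) =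
     (\<Prod>n. rpow (theta_factor (Suc n))
         (of_nat (Suc n) ^ 2 / 2 *
          of_int (intersection S L L + r ^ 2 * euler_char S (structure_sheaf S))))
       * (at_q0 A powi (intersection S L (canonical_bundle S))
          * at_q0 B powi (intersection S (canonical_bundle S) (canonical_bundle S))
          / rpow (Delta_tilde * (1 + of_int (r ^ 2) * divisor_series))
              (of_int (euler_char S (structure_sheaf S)) / 2))"
proof -
  define P where "P = at_q0 (L20_lift (- phi_m2_1))"
  have t0: "fps_nth (theta_factor (Suc n)) 0 = 1" for n
    using agree_nth[OF agree_one_theta_factor, of 0] by simp
  have rpow_P: "rpow P a = (\<Prod>n. rpow (theta_factor (Suc n)) (of_nat (Suc n) ^ 2 * a))" for a
    unfolding P_def at_q0_L20_lift_neg
    by (subst rpow_prodinf) (simp_all add: rpow_agree_one agree_one_theta_factor rpow_rpow t0)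
  have "fps_nth P 0 = 1"
    by (simp add: P_def)
  then have "P ^ nat (r ^ 2) =
      (\<Prod>n. rpow (theta_factor (Suc n)) (of_nat (Suc n ^ 2 * nat (r ^ 2))))"
    unfolding of_nat_mult of_nat_power rpow_P[symmetric] by (rule rpow_of_nat[symmetric])
  then have P_power: "P ^ nat (r ^ 2) = (\<Prod>n. theta_factor (Suc n) ^ (Suc n ^ 2 * nat (r ^ 2)))"
    unfolding rpow_of_nat[OF t0] .
  define e where "e = intersection S L L + r ^ 2 * euler_char S (structure_sheaf S)"
  have P_rpow: "rpow P (1 / 2 * of_int e) =
      (\<Prod>n. rpow (theta_factor (Suc n)) (of_nat (Suc n) ^ 2 / 2 * of_int e))"
    by (simp add: rpow_P)
  have Ell: "at_q0 (Abs_fps (\<lambda>n. Ell (hilb S n) (tensor (mu S n L) (line_power (E_bundle S n) r)))) =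
      Abs_fps (\<lambda>n. chi_y (hilb S n) (tensor (mu S n L) (line_power (E_bundle S n) r)))"
    by (rule fps_ext) (simp add: Ell_nth_0)
  have zd: "at_q0 (zdlog (L20_lift phi_m2_1)) = - divisor_series"
    by (simp add: at_q0_zdlog zdlog_at_q0_L20_lift)
  have "Abs_fps (\<lambda>n. chi_y (hilb S n) (tensor (mu S n L) (line_power (E_bundle S n) r)))
        oo (fps_X * P ^ nat (r ^ 2)) =
      rpow P (1 / 2 * of_int e)
        * at_q0 A powi (intersection S L (canonical_bundle S))
        * at_q0 B powi (intersection S (canonical_bundle S) (canonical_bundle S))
        / rpow (Delta_tilde * (1 - of_int (r ^ 2) * - divisor_series))
            (of_int (euler_char S (structure_sheaf S)) / 2)"
    using arg_cong[OF assms(3)[OF assms(4,5)], of at_q0]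
    by (simp only: at_q0_compose at_q0_divide[OF rpow_nth_0_nested] at_q0_mult at_q0_rpow
        at_q0_powi at_q0_diff at_q0_one at_q0_of_int at_q0_power at_q0_X Ell zd at_q0_L_lift
        P_def e_def)
  then show ?thesis
    unfolding P_power P_rpow unfolding e_def by (simp add: fps_divide_unit mult.assoc)
qed

end
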